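(* Let $\mathcal{A}$ be a finite dimensional C*-algebra and let $E$ be a Hilbert $\mathcal{A}$-module that is not finitely generated. Then every nonzero compact operator $K \in \mathcal{K}(E)$ has a proper nonzero hyperinvariant submodule.
   Context: Hilbert $\mathcal{A}$-modules are right Hilbert C*-modules $E$ over $\mathcal{A}$ with $\mathcal{A}$-valued inner product $\langle\cdot,\cdot\rangle$, linear in the second variable, complete in the norm $\|x\|=\|\langle x,x\rangle\|^{1/2}$. "Finitely generated" means finitely generated as a right $\mathcal{A}$-module. $\mathcal{L}(E)$ is the C*-algebra of all adjointable operators on $E$ (maps $T:E\to E$ having an adjoint $T^*$ with $\langle Tx,y\rangle=\langle x,T^*y\rangle$). For $x,y\in E$ let $\theta_{x,y}(z)=x\langle y,z\rangle$; $\mathcal{K}(E)$ is the operator-norm closure in $\mathcal{L}(E)$ of the linear span of $\{\theta_{x,y}:x,y\in E\}$, and its elements are called compact operators on $E$. A closed submodule $W$ of $E$ is $T$-invariant (an invariant submodule for $T\in\mathcal{L}(E)$) if $T(W)\subseteq W$. An invariant submodule $W$ for $T$ is hyperinvariant if $S(W)\subseteq W$ for every $S\in\mathcal{L}(E)$ with $TS=ST$. Proper nonzero means $\{0\}\neq W\neq E$. *)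

theory Defs
  imports "HOL-Analysis.Analysis"
begin

class complex_vector_space = real_vector +
  fixes scaleC :: "complex \<Rightarrow> 'a \<Rightarrow> 'a" (infixr "*\<^sub>C" 75)
  assumes scaleC_add_right: "c *\<^sub>C (x + y) = c *\<^sub>C x + c *\<^sub>C y"
    and scaleC_add_left: "(c + d) *\<^sub>C x = c *\<^sub>C x + d *\<^sub>C x"
    and scaleC_scaleC: "c *\<^sub>C (d *\<^sub>C x) = (c * d) *\<^sub>C x"
    and scaleC_one: "1 *\<^sub>C x = x"
    and scaleR_scaleC: "r *\<^sub>R x = complex_of_real r *\<^sub>C x"

global_interpretation cvs: vector_space "scaleC :: complex \<Rightarrow> 'a \<Rightarrow> 'a::complex_vector_space"
  by unfold_locales (simp_all add: scaleC_add_right scaleC_add_left scaleC_scaleC scaleC_one)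

class complex_banach_space = complex_vector_space + banach +
  assumes norm_scaleC: "norm (c *\<^sub>C x) = cmod c * norm x"

text \<open>A unit is not required: the class \<^class>\<open>real_normed_algebra\<close> is not unital.\<close>

class cstar_algebra = complex_banach_space + real_normed_algebra +
  fixes cstar :: "'a \<Rightarrow> 'a"
  assumes scaleC_mult_left: "(c *\<^sub>C x) * y = c *\<^sub>C (x * y)"
    and scaleC_mult_right: "x * (c *\<^sub>C y) = c *\<^sub>C (x * y)"
    and cstar_add: "cstar (x + y) = cstar x + cstar y"
    and cstar_scaleC: "cstar (c *\<^sub>C x) = cnj c *\<^sub>C cstar x"
    and cstar_mult: "cstar (x * y) = cstar y * cstar x"
    and cstar_cstar: "cstar (cstar x) = x"
    and cstar_identity: "norm (cstar x * x) = (norm x)\<^sup>2"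

definition cfinite_dim :: "'a::complex_vector_space set \<Rightarrow> bool" where
  "cfinite_dim V \<longleftrightarrow> (\<exists>B. finite B \<and> B \<subseteq> V \<and> V \<subseteq> cvs.span B)"

definition cstar_positive :: "'a::cstar_algebra \<Rightarrow> bool" where
  "cstar_positive a \<longleftrightarrow> (\<exists>b. a = cstar b * b)"

text \<open>
  The module is the whole type \<open>'e\<close>. Its norm, topology and completeness are those of
  the Banach space class; \<open>norm_ip\<close> says that this norm is the one induced by the inner product.
\<close>

locale hilbert_module =
  fixes act :: "'e::complex_banach_space \<Rightarrow> 'a::cstar_algebra \<Rightarrow> 'e"
    and ip :: "'e \<Rightarrow> 'e \<Rightarrow> 'a"
  assumes act_add_left: "act (x + y) a = act x a + act y a"
    and act_add_right: "act x (a + b) = act x a + act x b"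
    and act_mult: "act x (a * b) = act (act x a) b"
    and act_scaleC_left: "act (c *\<^sub>C x) a = c *\<^sub>C act x a"
    and act_scaleC_right: "act x (c *\<^sub>C a) = c *\<^sub>C act x a"
    and ip_add_right: "ip x (y + z) = ip x y + ip x z"
    and ip_scaleC_right: "ip x (c *\<^sub>C y) = c *\<^sub>C ip x y"
    and ip_act_right: "ip x (act y a) = ip x y * a"
    and ip_commute: "ip y x = cstar (ip x y)"
    and ip_positive: "cstar_positive (ip x x)"
    and ip_definite: "ip x x = 0 \<Longrightarrow> x = 0"
    and norm_ip: "norm x = sqrt (norm (ip x x))"

definition fin_gen_module :: "('e::complex_banach_space \<Rightarrow> 'a::cstar_algebra \<Rightarrow> 'e) \<Rightarrow> bool" where
  "fin_gen_module act \<longleftrightarrow> (\<exists>G. finite G \<and> (\<forall>x. \<exists>a. x = (\<Sum>g\<in>G. act g (a g))))"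

text \<open>Adjointable maps are automatically bounded and \<open>'a\<close>-linear, so neither is required.\<close>

definition adjointable_ops :: "('e::complex_banach_space \<Rightarrow> 'e \<Rightarrow> 'a::cstar_algebra) \<Rightarrow> ('e \<Rightarrow> 'e) set" where
  "adjointable_ops ip = {T. \<exists>T'. \<forall>x y. ip (T x) y = ip x (T' y)}"

definition theta_op ::
    "('e::complex_banach_space \<Rightarrow> 'a::cstar_algebra \<Rightarrow> 'e) \<Rightarrow> ('e \<Rightarrow> 'e \<Rightarrow> 'a) \<Rightarrow> 'e \<Rightarrow> 'e \<Rightarrow> 'e \<Rightarrow> 'e" where
  "theta_op act ip x y = (\<lambda>z. act x (ip y z))"

definition theta_span ::
    "('e::complex_banach_space \<Rightarrow> 'a::cstar_algebra \<Rightarrow> 'e) \<Rightarrow> ('e \<Rightarrow> 'e \<Rightarrow> 'a) \<Rightarrow> ('e \<Rightarrow> 'e) set" where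
  "theta_span act ip =
     {F. \<exists>(n::nat) c x y. F = (\<lambda>z. \<Sum>i<n. c i *\<^sub>C theta_op act ip (x i) (y i) z)}"

text \<open>
  Operator-norm closure: the innermost condition says that the operator norm of \<open>K - F\<close> is at
  most \<open>\<epsilon>\<close>. It is spelled out because \<^const>\<open>onorm\<close> is meaningful only for maps already known
  to be bounded.
\<close>

lemma onorm_le_iff_bound:
  assumes "bounded_linear f" "0 \<le> \<epsilon>"
  shows "onorm f \<le> \<epsilon> \<longleftrightarrow> (\<forall>z. norm (f z) \<le> \<epsilon> * norm z)"
  by (meson assms onorm onorm_bound order_trans mult_right_mono norm_ge_zero)

definition compact_module_ops ::
    "('e::complex_banach_space \<Rightarrow> 'a::cstar_algebra \<Rightarrow> 'e) \<Rightarrow> ('e \<Rightarrow> 'e \<Rightarrow> 'a) \<Rightarrow> ('e \<Rightarrow> 'e) set" where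
  "compact_module_ops act ip =
     {K \<in> adjointable_ops ip.
        \<forall>\<epsilon>>0. \<exists>F\<in>theta_span act ip. \<forall>z. norm (K z - F z) \<le> \<epsilon> * norm z}"

definition closed_submodule ::
    "('e::complex_banach_space \<Rightarrow> 'a::cstar_algebra \<Rightarrow> 'e) \<Rightarrow> 'e set \<Rightarrow> bool" where
  "closed_submodule act W \<longleftrightarrow>
     closed W \<and> cvs.subspace W \<and> (\<forall>x\<in>W. \<forall>a. act x a \<in> W)"

definition invariant_submodule ::
    "('e::complex_banach_space \<Rightarrow> 'a::cstar_algebra \<Rightarrow> 'e) \<Rightarrow> ('e \<Rightarrow> 'e) \<Rightarrow> 'e set \<Rightarrow> bool" where
  "invariant_submodule act T W \<longleftrightarrow> closed_submodule act W \<and> T ` W \<subseteq> W"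

definition hyperinvariant_submodule ::
    "('e::complex_banach_space \<Rightarrow> 'a::cstar_algebra \<Rightarrow> 'e) \<Rightarrow> ('e \<Rightarrow> 'e \<Rightarrow> 'a) \<Rightarrow> ('e \<Rightarrow> 'e) \<Rightarrow> 'e set \<Rightarrow> bool" where
  "hyperinvariant_submodule act ip T W \<longleftrightarrow>
     invariant_submodule act T W \<and>
     (\<forall>S\<in>adjointable_ops ip. T \<circ> S = S \<circ> T \<longrightarrow> S ` W \<subseteq> W)"

end

theory Submission imports Defs begin

text \<open>
  Over a finite dimensional algebra the maps \<open>\<theta>\<^bsub>x,y\<^esub>\<close> send the unit ball into a compact set, so
  \<open>K\<close> is a compact operator on the Banach space underlying \<open>E\<close>. It is not a scalar: an element of
  the span of the \<open>\<theta>\<^bsub>x,y\<^esub>\<close> close to a nonzero scalar is onto, which would make \<open>E\<close> finitely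
  generated. Lomonosov's theorem then gives a closed subspace invariant under every bounded
  complex-linear operator commuting with \<open>K\<close>; these include the adjointable ones (bounded by the
  Baire category theorem) and, since \<open>K\<close> is \<open>\<A>\<close>-linear, the right multiplications by elements of
  the algebra. Lomonosov's theorem is proved by Hilden's method. A compact operator without
  eigenvalues is shown to be quasinilpotent by averaging resolvents over roots of unity, which
  avoids vector-valued holomorphic functions.
\<close>

section \<open>Bounded complex-linear maps and compact operators\<close>

lemma bounded_bilinear_scaleC: "bounded_bilinear (scaleC :: complex \<Rightarrow> 'a \<Rightarrow> 'a::complex_banach_space)"
proof
  fix a b :: complex and x y :: 'a and r :: real
  show "(a + b) *\<^sub>C x = a *\<^sub>C x + b *\<^sub>C x" by (rule scaleC_add_left)
  show "a *\<^sub>C (x + y) = a *\<^sub>C x + a *\<^sub>C y" by (rule scaleC_add_right)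
  show "(r *\<^sub>R a) *\<^sub>C x = r *\<^sub>R a *\<^sub>C x"
    by (simp add: scaleR_scaleC scaleC_scaleC scaleR_conv_of_real)
  show "a *\<^sub>C r *\<^sub>R x = r *\<^sub>R a *\<^sub>C x"
    by (simp add: scaleR_scaleC scaleC_scaleC mult.commute)
  show "\<exists>K. \<forall>a (x::'a). norm (a *\<^sub>C x) \<le> norm a * norm x * K"
    by (rule exI[of _ 1]) (simp add: norm_scaleC)
qed

lemmas tendsto_scaleC = bounded_bilinear.tendsto[OF bounded_bilinear_scaleC]
lemmas continuous_on_scaleC = bounded_bilinear.continuous_on[OF bounded_bilinear_scaleC]

definition complex_bounded_linear :: "('e::complex_banach_space \<Rightarrow> 'f::complex_banach_space) \<Rightarrow> bool" where
  "complex_bounded_linear f \<longleftrightarrow> bounded_linear f \<and> (\<forall>c x. f (c *\<^sub>C x) = c *\<^sub>C f x)"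

text \<open>Ranges over all bounded complex-linear maps, so that right multiplications by algebra
  elements, which may fail to be module linear, belong to it when \<open>K\<close> is module
  linear.\<close>

definition commutant :: "('e::complex_banach_space \<Rightarrow> 'e) \<Rightarrow> ('e \<Rightarrow> 'e) set" where
  "commutant K = {S. complex_bounded_linear S \<and> (\<forall>x. K (S x) = S (K x))}"

definition compact_operator :: "('e::complex_banach_space \<Rightarrow> 'e) \<Rightarrow> bool" where
  "compact_operator K \<longleftrightarrow> complex_bounded_linear K \<and> compact (closure (K ` cball 0 1))"

lemma complex_bounded_linearD:
  assumes "complex_bounded_linear f"
  shows "bounded_linear f" "f (c *\<^sub>C x) = c *\<^sub>C f x"
  using assms by (auto simp: complex_bounded_linear_def)

lemma complex_bounded_linearI:
  assumes "\<And>x y. f (x + y) = f x + f y" "\<And>c x. f (c *\<^sub>C x) = c *\<^sub>C f x"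
    and "\<And>x. norm (f x) \<le> B * norm x"
  shows "complex_bounded_linear f"
proof -
  have "bounded_linear f"
    by (rule bounded_linear_intro[where K = B])
       (use assms in \<open>auto simp: scaleR_scaleC mult.commute\<close>)
  then show ?thesis using assms(2) by (simp add: complex_bounded_linear_def)
qed

lemma complex_bounded_linear_compose:
  assumes "complex_bounded_linear f" "complex_bounded_linear g"
  shows "complex_bounded_linear (\<lambda>x. f (g x))"
  using assms bounded_linear_compose by (auto simp: complex_bounded_linear_def)

lemma compact_operatorD:
  assumes "compact_operator K"
  shows "complex_bounded_linear K" "bounded_linear K" "K (c *\<^sub>C x) = c *\<^sub>C K x"
  using assms by (auto simp: compact_operator_def complex_bounded_linear_def)

section \<open>Resolvent bounds on discs in the absence of eigenvalues\<close>

text \<open>Otherwise there are unit vectors \<open>v n\<close> with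
  \<open>v n - w n *\<^sub>C K (v n)\<close> tending to 0. Along a subsequence \<open>w n\<close>
  and \<open>K (v n)\<close> converge, hence so does \<open>v n\<close>, and its limit is an
  eigenvector. The constant is uniform over the disc, as the averaging over rotations of
  \<open>w\<close> requires.\<close>

lemma compact_operator_bounded_below:
  fixes K :: "'e::complex_banach_space \<Rightarrow> 'e"
  assumes K: "compact_operator K" and no_eig: "\<And>c x. K x = c *\<^sub>C x \<Longrightarrow> x = 0"
  shows "\<exists>C>0. \<forall>w v. cmod w \<le> R \<longrightarrow> norm v \<le> C * norm (v - w *\<^sub>C K v)"
proof (rule ccontr)
  assume neg: "\<not> ?thesis"
  \<comment> \<open>The negated claim is used with the constant \<open>real (Suc n)\<close>, and
    \<open>v\<close> is rescaled to norm 1.\<close>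
  have "\<exists>w v. cmod w \<le> R \<and> norm v = 1 \<and> norm (v - w *\<^sub>C K v) \<le> 1 / real (Suc n)" for n
  proof -
    obtain w v where w: "cmod w \<le> R" and v: "norm v > real (Suc n) * norm (v - w *\<^sub>C K v)"
      using neg by (metis of_nat_0_less_iff zero_less_Suc not_le)
    have pos: "norm v > 0" using v by (smt (verit) mult_nonneg_nonneg norm_ge_zero of_nat_0_le_iff)
    let ?a = "complex_of_real (1 / norm v)"
    let ?u = "?a *\<^sub>C v"
    have "?u - w *\<^sub>C K ?u = ?a *\<^sub>C (v - w *\<^sub>C K v)"
      using compact_operatorD[OF K]
      by (simp add: cvs.scale_right_diff_distrib scaleC_scaleC mult.commute)
    then have "norm (?u - w *\<^sub>C K ?u) = norm (v - w *\<^sub>C K v) / norm v"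
      by (simp add: norm_scaleC norm_divide)
    also have "\<dots> \<le> 1 / real (Suc n)"
      using v pos by (simp add: field_simps del: of_nat_Suc)
    finally have "norm (?u - w *\<^sub>C K ?u) \<le> 1 / real (Suc n)" .
    moreover have "norm ?u = 1" using pos by (simp add: norm_scaleC norm_divide)
    ultimately show ?thesis using w by blast
  qed
  then obtain w v where w: "\<And>n. cmod (w n) \<le> R" and v: "\<And>n. norm (v n) = 1"
    and small: "\<And>n. norm (v n - w n *\<^sub>C K (v n)) \<le> 1 / real (Suc n)" by metis
  have "compact (cball (0::complex) R)" by simp
  then obtain w0 r where r: "strict_mono r" and w0: "(w \<circ> r) \<longlonglongrightarrow> w0"
    using w unfolding compact_def by (metis mem_cball_0)
  have "compact (closure (K ` cball 0 1))" using K by (simp add: compact_operator_def)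
  moreover have "(K \<circ> v \<circ> r) n \<in> closure (K ` cball 0 1)" for n
    using v closure_subset by (auto simp: image_iff intro!: subsetD[OF closure_subset])
  ultimately obtain y s where s: "strict_mono s" and y: "(K \<circ> v \<circ> r \<circ> s) \<longlonglongrightarrow> y"
    unfolding compact_def by blast
  define q where "q = r \<circ> s"
  have q: "strict_mono q" using r s by (simp add: q_def strict_mono_o)
  have wq: "(\<lambda>n. w (q n)) \<longlonglongrightarrow> w0"
    using LIMSEQ_subseq_LIMSEQ[OF w0 s] by (simp add: o_def q_def)
  have yq: "(\<lambda>n. K (v (q n))) \<longlonglongrightarrow> y" using y by (simp add: o_def q_def)
  have "(\<lambda>n. v n - w n *\<^sub>C K (v n)) \<longlonglongrightarrow> 0"
    by (rule Lim_null_comparison[OF _ LIMSEQ_Suc[OF lim_1_over_n]])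
       (use small in auto)
  from LIMSEQ_subseq_LIMSEQ[OF this q]
  have "(\<lambda>n. (v (q n) - w (q n) *\<^sub>C K (v (q n))) + w (q n) *\<^sub>C K (v (q n))) \<longlonglongrightarrow> 0 + w0 *\<^sub>C y"
    by (intro tendsto_add tendsto_scaleC wq yq) (simp add: o_def)
  then have vq: "(\<lambda>n. v (q n)) \<longlonglongrightarrow> w0 *\<^sub>C y" by simp
  have n1: "norm (w0 *\<^sub>C y) = 1"
    using tendsto_norm[OF vq] v by (simp add: LIMSEQ_const_iff)
  have "(\<lambda>n. K (v (q n))) \<longlonglongrightarrow> K (w0 *\<^sub>C y)"
    by (rule bounded_linear.tendsto[OF compact_operatorD(2)[OF K] vq])
  then have "y = K (w0 *\<^sub>C y)" using yq LIMSEQ_unique by blast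
  \<comment> \<open>The limit has norm 1, which rules out \<open>w0 = 0\<close> and makes
    \<open>1 / w0\<close> an eigenvalue.\<close>
  moreover have "w0 \<noteq> 0" using n1 by (auto simp: norm_scaleC)
  ultimately have "K (w0 *\<^sub>C y) = (1 / w0) *\<^sub>C (w0 *\<^sub>C y)"
    by (simp add: scaleC_scaleC scaleC_one)
  from no_eig[OF this] have "norm (w0 *\<^sub>C y) = 0" by (simp only: norm_zero)
  with n1 show False by simp
qed

section \<open>Quasinilpotency by averaging over roots of unity\<close>

text \<open>The summands are the powers of an \<open>n\<close>-th root of unity \<open>z\<close>;
  here \<open>z = 1\<close> would make \<open>k / n\<close> an integer, so the geometric sum
  vanishes.\<close>

lemma sum_root_unity_powers:
  assumes "0 < k" "k < n"
  shows "(\<Sum>j<n. (cis (2 * pi / real n) ^ j) ^ k) = 0"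
proof -
  define z where "z = cis (2 * pi / real n) ^ k"
  have z: "z = cis (2 * pi * (real k / real n))"
    by (simp add: z_def Complex.DeMoivre mult_ac)
  have "z \<noteq> 1"
  proof
    assume "z = 1"
    then have "cos (2 * pi * (real k / real n)) = 1" unfolding z by (metis cis.simps(1) one_complex.simps(1))
    then obtain i :: int where "2 * pi * (real k / real n) = real_of_int i * 2 * pi"
      by (auto simp: cos_one_2pi_int)
    then have "2 * pi * (real k / real n) = 2 * pi * real_of_int i" by (simp add: mult_ac)
    then have e: "real k / real n = real_of_int i" by (subst (asm) mult_cancel_left) simp
    have "0 < real k / real n" "real k / real n < 1" using assms by auto
    then show False unfolding e by auto
  qed
  moreover have "z ^ n = 1"
  proof -
    have "cis (2 * pi / real n) ^ n = 1" using assms by (simp add: Complex.DeMoivre)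
    then show ?thesis unfolding z_def by (metis power_commutes power_mult mult.commute power_one)
  qed
  ultimately have "(\<Sum>j<n. z ^ j) = 0" by (simp add: geometric_sum)
  then show ?thesis unfolding z_def by (simp add: power_mult[symmetric] mult.commute)
qed

text \<open>Truncated Neumann series for the inverse of \<open>1 - w K\<close> at
  \<open>b\<close>.\<close>

definition geometric_partial_sum ::
    "('e::complex_banach_space \<Rightarrow> 'e) \<Rightarrow> nat \<Rightarrow> complex \<Rightarrow> 'e \<Rightarrow> 'e" where
  "geometric_partial_sum K n w b = (\<Sum>k<n. w ^ k *\<^sub>C (K ^^ k) b)"

text \<open>The right-hand side depends on \<open>w\<close> only through \<open>w ^ n\<close>, so it
  is unchanged when \<open>w\<close> is rotated by an \<open>n\<close>-th root of unity.\<close>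

lemma geometric_partial_sum_telescope:
  assumes "complex_bounded_linear K"
  shows "geometric_partial_sum K n w b - w *\<^sub>C K (geometric_partial_sum K n w b) =
    b - w ^ n *\<^sub>C (K ^^ n) b"
proof (induction n)
  case 0
  then show ?case
    using linear_simps(3)[OF complex_bounded_linearD(1)[OF assms]]
    by (simp add: geometric_partial_sum_def scaleC_one)
next
  case (Suc n)
  let ?S = "geometric_partial_sum K n w b" and ?d = "w ^ n *\<^sub>C (K ^^ n) b"
  have add: "K (x + y) = K x + K y" for x y
    using complex_bounded_linearD(1)[OF assms] by (simp add: linear_simps)
  have "geometric_partial_sum K (Suc n) w b = ?S + ?d" by (simp add: geometric_partial_sum_def)
  moreover have "w *\<^sub>C K ?d = w ^ Suc n *\<^sub>C (K ^^ Suc n) b"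
    by (simp add: complex_bounded_linearD(2)[OF assms] scaleC_scaleC)
  ultimately have "geometric_partial_sum K (Suc n) w b - w *\<^sub>C K (geometric_partial_sum K (Suc n) w b) =
      (?S - w *\<^sub>C K ?S) + ?d - w ^ Suc n *\<^sub>C (K ^^ Suc n) b"
    by (simp only: add scaleC_add_right) simp
  then show ?case unfolding Suc by simp
qed

text \<open>After exchanging the sums, averaging over the rotations kills every power
  \<open>0 < k < n\<close> and leaves the constant term.\<close>

lemma geometric_partial_sum_average:
  fixes K :: "'e::complex_banach_space \<Rightarrow> 'e"
  assumes "0 < n"
  shows "(\<Sum>j<n. geometric_partial_sum K n (w * cis (2 * pi / real n) ^ j) b) = of_nat n *\<^sub>C b"
proof -
  let ?\<omega> = "cis (2 * pi / real n)"
  have "(\<Sum>j<n. geometric_partial_sum K n (w * ?\<omega> ^ j) b) =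
      (\<Sum>k<n. \<Sum>j<n. (w * ?\<omega> ^ j) ^ k *\<^sub>C (K ^^ k) b)"
    unfolding geometric_partial_sum_def by (rule sum.swap)
  also have "\<dots> = (\<Sum>k<n. (w ^ k * (\<Sum>j<n. (?\<omega> ^ j) ^ k)) *\<^sub>C (K ^^ k) b)"
    by (simp add: cvs.scale_sum_left[symmetric] power_mult_distrib sum_distrib_left)
  also have "\<dots> = (\<Sum>k<n. if k = 0 then of_nat n *\<^sub>C b else 0)"
    by (intro sum.cong refl) (auto simp: sum_root_unity_powers)
  also have "\<dots> = of_nat n *\<^sub>C b" using assms by simp
  finally show ?thesis .
qed

lemma complex_bounded_linear_funpow:
  fixes K :: "'e::complex_banach_space \<Rightarrow> 'e"
  assumes "complex_bounded_linear K"
  shows "complex_bounded_linear (K ^^ n)"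
proof (induction n)
  case 0
  have e: "K ^^ 0 = (\<lambda>x. x)" by auto
  show ?case unfolding e by (simp add: complex_bounded_linear_def bounded_linear_ident)
next
  case (Suc n)
  then show ?case using complex_bounded_linear_compose[OF assms Suc] by (simp add: o_def)
qed

text \<open>
  The resolvents at \<open>w\<close> and \<open>\<zeta> w\<close> with \<open>\<zeta>\<^sup>n = -1\<close> are close, whereas their averages over the
  rotations of \<open>w\<close> by \<open>n\<close>-th roots of unity are the inverses of \<open>1 - M\<close> and \<open>1 + M\<close>, where
  \<open>M = t\<^sup>n K\<^sup>n\<close>. Applied to \<open>(1 - M\<^sup>2) u\<close>, these averages differ by \<open>2 M u\<close>.
\<close>

lemma power_bound_of_resolvent_bound:
  fixes K :: "'e::complex_banach_space \<Rightarrow> 'e"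
  assumes K: "complex_bounded_linear K" and C: "C > 0"
    and res: "\<And>w v. cmod w \<le> t \<Longrightarrow> norm v \<le> C * norm (v - w *\<^sub>C K v)"
    and t: "0 \<le> t" and n: "0 < n" and t1: "t ^ n * onorm (K ^^ n) \<le> 1"
  shows "t ^ n * norm ((K ^^ n) u) \<le> C\<^sup>2 * onorm K * t * pi / real n * norm u"
proof -
  define M where "M x = of_real (t ^ n) *\<^sub>C (K ^^ n) x" for x
  have Kn: "complex_bounded_linear (K ^^ n)" by (rule complex_bounded_linear_funpow[OF K])
  have blK: "bounded_linear K" and blKn: "bounded_linear (K ^^ n)"
    using K Kn by (simp_all add: complex_bounded_linear_def)
  have Mnorm: "norm (M x) \<le> norm x" for x
  proof -
    have "norm (M x) = t ^ n * norm ((K ^^ n) x)" using t by (simp add: M_def norm_scaleC norm_power)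
    also have "\<dots> \<le> t ^ n * (onorm (K ^^ n) * norm x)"
      by (intro mult_left_mono onorm blKn) (use t in simp)
    also have "\<dots> \<le> norm x"
      using mult_right_mono[OF t1, of "norm x"] by (simp add: mult.assoc)
    finally show ?thesis .
  qed
  have M_add: "M (x + y) = M x + M y" and M_diff: "M (x - y) = M x - M y" for x y
    using blKn by (simp_all add: M_def linear_simps scaleC_add_right cvs.scale_right_diff_distrib)
  define \<omega> where "\<omega> = cis (2 * pi / real n)"
  define \<zeta> where "\<zeta> = cis (pi / real n)"
  have \<omega>n: "(\<omega> ^ j) ^ n = 1" for j
  proof -
    have "\<omega> ^ n = 1" using n by (simp add: \<omega>_def Complex.DeMoivre)
    then show ?thesis by (metis power_commutes power_mult mult.commute power_one)
  qed
  have \<zeta>n: "\<zeta> ^ n = -1" using n by (simp add: \<zeta>_def Complex.DeMoivre)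
  define w where "w j = of_real t * \<omega> ^ j" for j
  define w' where "w' j = (of_real t * \<zeta>) * \<omega> ^ j" for j
  \<comment> \<open>Since \<omega>^n = 1 and \<zeta>^n = -1, the telescoping identity sends
    \<open>a j\<close> to (1 - M)(1 + M) u and \<open>a' j\<close> to (1 + M)(1 - M) u, which are
    the same vector \<open>v\<close>.\<close>
  define a where "a j = geometric_partial_sum K n (w j) (u + M u)" for j
  define a' where "a' j = geometric_partial_sum K n (w' j) (u - M u)" for j
  define v where "v = u - M (M u)"
  have av: "a j - w j *\<^sub>C K (a j) = v" for j
    unfolding a_def geometric_partial_sum_telescope[OF K]
    by (simp add: w_def power_mult_distrib \<omega>n v_def flip: M_def of_real_power) (simp add: M_add)
  have av': "a' j - w' j *\<^sub>C K (a' j) = v" for j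
    unfolding a'_def geometric_partial_sum_telescope[OF K]
    by (simp add: w'_def power_mult_distrib \<omega>n \<zeta>n v_def flip: M_def of_real_power) (simp add: M_diff)
  have wn: "cmod (w j) \<le> t" "cmod (w' j) \<le> t" for j
    using t by (simp_all add: w_def w'_def \<omega>_def \<zeta>_def norm_mult norm_power)
  \<comment> \<open>The chord from 1 to \<zeta> is at most its arc \<open>pi / real n\<close>; this
    is the source of the decay in \<open>n\<close>.\<close>
  have ww: "cmod (w j - w' j) \<le> t * (pi / real n)" for j
  proof -
    have "w j - w' j = of_real t * \<omega> ^ j * (1 - \<zeta>)" by (simp add: w_def w'_def algebra_simps)
    then have "cmod (w j - w' j) = t * cmod (\<zeta> - 1)"
      using t by (simp add: norm_mult norm_power \<omega>_def norm_minus_commute)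
    also have "cmod (\<zeta> - 1) = 2 * \<bar>sin (pi / real n / 2)\<bar>"
      using dist_exp_i_1[of "pi / real n"] by (simp add: \<zeta>_def cis_conv_exp)
    also have "\<dots> \<le> pi / real n" using abs_sin_x_le_abs_x[of "pi / real n / 2"] by simp
    finally show ?thesis using t by (simp add: mult_left_mono)
  qed
  have vn: "norm v \<le> 2 * norm u"
    unfolding v_def using norm_triangle_ineq4[of u "M (M u)"] Mnorm[of "M u"] Mnorm[of u] by linarith
  \<comment> \<open>Resolvent identity: \<open>res\<close> is applied once to \<open>a' j\<close>
    and once to the difference, giving the square of \<open>C\<close>; the factor 2 comes from
    \<open>vn\<close>.\<close>
  have diff: "norm (a j - a' j) \<le> 2 * (C\<^sup>2 * onorm K * t * pi / real n * norm u)" for j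
  proof -
    have "(a j - a' j) - w j *\<^sub>C K (a j - a' j) = (a j - w j *\<^sub>C K (a j)) - (a' j - w j *\<^sub>C K (a' j))"
      using blK by (simp add: linear_simps cvs.scale_right_diff_distrib)
    also have "\<dots> = (w j - w' j) *\<^sub>C K (a' j)"
      unfolding av av'[of j, symmetric] by (simp add: cvs.scale_left_diff_distrib)
    finally have e: "(a j - a' j) - w j *\<^sub>C K (a j - a' j) = (w j - w' j) *\<^sub>C K (a' j)" .
    have "norm (a j - a' j) \<le> C * (cmod (w j - w' j) * norm (K (a' j)))"
      using res[OF wn(1)[of j], of "a j - a' j"] unfolding e norm_scaleC .
    also have "\<dots> \<le> C * ((t * (pi / real n)) * (onorm K * (C * (2 * norm u))))"
    proof -
      have "norm (a' j) \<le> C * norm v" using res[OF wn(2)[of j], of "a' j"] unfolding av' .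
      also have "\<dots> \<le> C * (2 * norm u)" using vn C by simp
      finally have "onorm K * norm (a' j) \<le> onorm K * (C * (2 * norm u))"
        by (intro mult_left_mono onorm_pos_le blK)
      then have "norm (K (a' j)) \<le> onorm K * (C * (2 * norm u))"
        using onorm[OF blK, of "a' j"] by linarith
      then show ?thesis using C ww[of j] t by (intro mult_left_mono mult_mono) auto
    qed
    finally show ?thesis by (simp add: power2_eq_square mult_ac)
  qed
  have "(\<Sum>j<n. a j - a' j) = of_nat n *\<^sub>C (u + M u) - of_nat n *\<^sub>C (u - M u)"
    unfolding sum_subtractf a_def a'_def w_def w'_def \<omega>_def
    by (simp only: geometric_partial_sum_average[OF n])
  also have "\<dots> = of_nat (2 * n) *\<^sub>C M u"
    by (simp only: mult_2 of_nat_add scaleC_add_left scaleC_add_right cvs.scale_right_diff_distrib) simp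
  finally have "norm (of_nat (2 * n) *\<^sub>C M u) = norm (\<Sum>j<n. a j - a' j)" by simp
  also have "\<dots> \<le> real (card {..<n}) * (2 * (C\<^sup>2 * onorm K * t * pi / real n * norm u))"
    by (rule sum_norm_bound) (rule diff)
  finally have "2 * real n * norm (M u) \<le> 2 * real n * (C\<^sup>2 * onorm K * t * pi / real n * norm u)"
    by (simp add: norm_scaleC norm_mult)
  then have "norm (M u) \<le> C\<^sup>2 * onorm K * t * pi / real n * norm u"
    by (rule mult_left_le_imp_le) (use n in simp)
  then show ?thesis using t by (simp add: M_def norm_scaleC norm_power)
qed

text \<open>If the bound fails at \<open>R\<close>, the scale \<open>t\<close> at which t^n K^n has
  norm 1 lies below \<open>R\<close>. There the preceding estimate bounds this norm by a constant
  over \<open>n\<close>, which is absurd for large \<open>n\<close>.\<close>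

lemma quasinilpotent_of_resolvent_bound:
  fixes K :: "'e::complex_banach_space \<Rightarrow> 'e"
  assumes K: "complex_bounded_linear K" and C: "C > 0" and R: "R > 0"
    and res: "\<And>w v. cmod w \<le> R \<Longrightarrow> norm v \<le> C * norm (v - w *\<^sub>C K v)"
  shows "\<exists>N. \<forall>n\<ge>N. R ^ n * onorm (K ^^ n) \<le> 1"
proof -
  have blK: "bounded_linear K" using K by (simp add: complex_bounded_linear_def)
  \<comment> \<open>Beyond \<open>N\<close> the factor \<open>?\<delta>\<close> below is less than 1
    for every \<open>t \<le> R\<close>. The choice also makes \<open>n\<close> positive, as the
    \<open>n\<close>-th root requires.\<close>
  obtain N :: nat where N: "C\<^sup>2 * onorm K * R * pi < real N" using reals_Archimedean2 by blast
  have "R ^ n * onorm (K ^^ n) \<le> 1" if "n \<ge> N" for n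
  proof (rule ccontr)
    assume neg: "\<not> ?thesis"
    have blKn: "bounded_linear (K ^^ n)"
      using complex_bounded_linear_funpow[OF K] by (simp add: complex_bounded_linear_def)
    let ?o = "onorm (K ^^ n)"
    have "0 \<le> C\<^sup>2 * onorm K * R * pi" using R onorm_pos_le[OF blK] by simp
    then have n: "0 < n" and Nn: "C\<^sup>2 * onorm K * R * pi < real n" using N that by linarith+
    have o: "0 < ?o" using neg onorm_pos_le[OF blKn] R by (cases "?o = 0") auto
    define t where "t = root n (1 / ?o)"
    have t0: "0 < t" using n o by (simp add: t_def)
    have tn: "t ^ n = 1 / ?o" unfolding t_def using n o by (intro real_root_pow_pos2) auto
    have "t ^ n \<le> R ^ n" unfolding tn using neg o by (simp add: field_simps)
    then have tR: "t \<le> R" using R by (simp add: power_mono_iff n t0 less_imp_le)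
    let ?\<delta> = "C\<^sup>2 * onorm K * t * pi / real n"
    have b: "t ^ n * norm ((K ^^ n) u) \<le> ?\<delta> * norm u" for u
      by (rule power_bound_of_resolvent_bound[OF K C res]) (use tR t0 n tn o in auto)
    have "?o \<le> ?\<delta> * ?o"
    proof (rule onorm_bound)
      show "0 \<le> ?\<delta> * ?o" using o t0 onorm_pos_le[OF blK] by simp
      show "norm ((K ^^ n) u) \<le> ?\<delta> * ?o * norm u" for u
        using b[of u] o unfolding tn by (simp add: field_simps)
    qed
    then have "1 * ?o \<le> ?\<delta> * ?o" by simp
    then have "1 \<le> ?\<delta>" using o by (rule mult_right_le_imp_le)
    moreover have "C\<^sup>2 * onorm K * t * pi \<le> C\<^sup>2 * onorm K * R * pi"
      using tR onorm_pos_le[OF blK] by (intro mult_right_mono mult_left_mono) auto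
    moreover have "real n \<le> C\<^sup>2 * onorm K * t * pi" using \<open>1 \<le> ?\<delta>\<close> n by (simp add: le_divide_eq)
    ultimately show False using Nn by linarith
  qed
  then show ?thesis by blast
qed

section \<open>The commutant and Lomonosov's theorem\<close>

lemma commutant_id: "(\<lambda>x. x) \<in> commutant K"
  by (simp add: commutant_def complex_bounded_linear_def bounded_linear_ident)

lemma commutant_compose:
  assumes "S \<in> commutant K" "T \<in> commutant K"
  shows "(\<lambda>x. S (T x)) \<in> commutant K"
  using assms complex_bounded_linear_compose by (auto simp: commutant_def)

lemma commutant_add:
  assumes "S \<in> commutant K" "T \<in> commutant K" "complex_bounded_linear K"
  shows "(\<lambda>x. S x + T x) \<in> commutant K"
  using assms bounded_linear_add
  by (auto simp: commutant_def complex_bounded_linear_def scaleC_add_right linear_simps)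

lemma complex_bounded_linear_scaleC: "complex_bounded_linear (\<lambda>x. c *\<^sub>C x)"
  by (simp add: complex_bounded_linear_def bounded_bilinear.bounded_linear_right[OF bounded_bilinear_scaleC]
      cvs.scale_left_commute)

lemma commutant_scaleC:
  assumes "complex_bounded_linear K"
  shows "(\<lambda>x. c *\<^sub>C x) \<in> commutant K"
  using assms complex_bounded_linear_scaleC by (auto simp: commutant_def complex_bounded_linearD)

text \<open>The commutant is an algebra containing the scalars, so the orbit of \<open>y\<close> is
  a subspace stable under it; continuity carries this over to the closure.\<close>

lemma closed_orbit_subspace:
  fixes K :: "'e::complex_banach_space \<Rightarrow> 'e"
  assumes K: "complex_bounded_linear K"
  defines "W \<equiv> \<lambda>y. closure {S y |S. S \<in> commutant K}"
  shows "closed (W y)" "cvs.subspace (W y)" "y \<in> W y" "T \<in> commutant K \<Longrightarrow> T ` W y \<subseteq> W y"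
proof -
  let ?O = "{S y |S. S \<in> commutant K}"
  show "closed (W y)" by (simp add: W_def)
  show y: "y \<in> W y" unfolding W_def
    using commutant_id[of K] by (intro subsetD[OF closure_subset] CollectI exI[of _ "\<lambda>x. x"]) simp
  show inv: "T ` W y \<subseteq> W y" if "T \<in> commutant K" for T
  proof -
    have "continuous_on (closure ?O) T"
      using that by (auto simp: commutant_def complex_bounded_linear_def intro: linear_continuous_on)
    moreover have "T ` ?O \<subseteq> ?O"
    proof clarify
      fix S assume "S \<in> commutant K"
      then show "\<exists>S'. T (S y) = S' y \<and> S' \<in> commutant K"
        using commutant_compose[OF that] by (intro exI[of _ "\<lambda>x. T (S x)"]) simp
    qed
    then have "T ` ?O \<subseteq> closure ?O" using closure_subset by (rule order_trans)
    ultimately show ?thesis unfolding W_def by (intro image_closure_subset) simp_all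
  qed
  show "cvs.subspace (W y)"
  proof (rule cvs.subspaceI)
    show "0 \<in> W y" using inv[OF commutant_scaleC[OF K, of 0]] y by force
    show "c *\<^sub>C x \<in> W y" if "x \<in> W y" for c x
      using inv[OF commutant_scaleC[OF K, of c]] that by blast
    fix a b assume "a \<in> W y" "b \<in> W y"
    then obtain f g where f: "\<And>n. f n \<in> ?O" "f \<longlonglongrightarrow> a" and g: "\<And>n. g n \<in> ?O" "g \<longlonglongrightarrow> b"
      unfolding W_def closure_sequential by blast
    have "f n + g n \<in> ?O" for n
    proof -
      obtain S T where "S \<in> commutant K" "T \<in> commutant K" "f n = S y" "g n = T y"
        using f(1)[of n] g(1)[of n] by blast
      then show ?thesis
        using commutant_add[of S K T, OF _ _ K] by (intro CollectI exI[of _ "\<lambda>x. S x + T x"]) simp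
    qed
    moreover have "(\<lambda>n. f n + g n) \<longlonglongrightarrow> a + b" using f g by (intro tendsto_add)
    ultimately show "a + b \<in> W y"
      unfolding W_def closure_sequential by (intro exI[of _ "\<lambda>n. f n + g n"]) simp
  qed
qed

text \<open>
  Hilden's argument: if every nonzero vector is cyclic for the commutant, finitely many
  \<open>S\<^sub>i\<close> in the commutant suffice to move any point of the compact set \<open>closure (K ` B)\<close> back
  into the ball \<open>B\<close>. Iterating gives \<open>S\<^bsub>i\<^sub>n\<^esub> \<dots> S\<^bsub>i\<^sub>1\<^esub> K\<^sup>n x\<^sub>0 \<in> B\<close>, and
  quasinilpotency makes these points tend to \<open>0 \<notin> B\<close>.
\<close>

lemma quasinilpotent_commutant_not_transitive:
  fixes K :: "'e::complex_banach_space \<Rightarrow> 'e"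
  assumes K: "compact_operator K" and nz: "K x0 \<noteq> 0"
    and quasi: "\<And>R. R > 0 \<Longrightarrow> \<exists>N. \<forall>n\<ge>N. R ^ n * onorm (K ^^ n) \<le> 1"
  shows "\<exists>y. y \<noteq> 0 \<and> closure {S y |S. S \<in> commutant K} \<noteq> UNIV"
proof (rule ccontr)
  assume "\<not> ?thesis"
  then have dense: "closure {S y |S. S \<in> commutant K} = UNIV" if "y \<noteq> 0" for y using that by blast
  have bl: "bounded_linear K" and cl: "complex_bounded_linear K" using compact_operatorD[OF K] by auto
  let ?k = "onorm K"
  have k: "0 < ?k" using onorm_pos_lt[OF bl] nz by blast
  \<comment> \<open>With this radius the ball \<open>B\<close> avoids 0, and \<open>K\<close> maps
    it to vectors of norm at least \<open>?k * r\<close>, so the closure of the image avoids 0 as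
    well.\<close>
  define r where "r = norm (K x0) / (2 * ?k)"
  have r: "0 < r" using nz k by (simp add: r_def)
  have Kx0: "norm (K x0) = 2 * (?k * r)" using k by (simp add: r_def)
  have rx0: "2 * r \<le> norm x0"
    using onorm[OF bl, of x0] k unfolding Kx0 by (simp add: mult.commute)
  define B where "B = cball x0 r"
  define C where "C = closure (K ` B)"
  have C_low: "?k * r \<le> norm y" if "y \<in> C" for y
  proof -
    have "K ` B \<subseteq> {y. ?k * r \<le> norm y}"
    proof clarify
      fix x assume "x \<in> B"
      then have "norm (x0 - x) \<le> r" by (simp add: B_def dist_norm)
      then have "norm (K (x0 - x)) \<le> ?k * r"
        using onorm[OF bl, of "x0 - x"] k by (meson mult_left_mono order_trans less_imp_le)
      moreover have "norm (K x0) - norm (K x) \<le> norm (K (x0 - x))"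
        using bl norm_triangle_ineq2 by (simp add: linear_simps)
      ultimately show "?k * r \<le> norm (K x)" using Kx0 by linarith
    qed
    moreover have "closed {y::'e. ?k * r \<le> norm y}" by (intro closed_Collect_le continuous_intros)
    ultimately show ?thesis using that closure_minimal unfolding C_def by blast
  qed
  have "compact C"
  proof -
    define s where "s = norm x0 + r"
    have s: "s > 0" using r by (simp add: s_def add_nonneg_pos)
    let ?D = "(\<lambda>y. s *\<^sub>R y) ` closure (K ` cball 0 1)"
    have D: "compact ?D" using K compact_scaling unfolding compact_operator_def by blast
    have "K ` B \<subseteq> ?D"
    proof clarify
      fix x assume "x \<in> B"
      then have "norm (x - x0) \<le> r" by (simp add: B_def dist_norm norm_minus_commute)
      then have "norm x \<le> s" using norm_triangle_sub[of x x0] by (simp add: s_def)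
      then have "x /\<^sub>R s \<in> cball 0 1" using s by (simp add: field_simps)
      then have "K (x /\<^sub>R s) \<in> closure (K ` cball 0 1)"
        by (intro subsetD[OF closure_subset] imageI)
      moreover have "K x = s *\<^sub>R K (x /\<^sub>R s)" using bl s by (simp add: linear_simps)
      ultimately show "K x \<in> ?D" by blast
    qed
    then have "C \<subseteq> ?D" unfolding C_def using D by (simp add: closure_minimal compact_imp_closed)
    then show ?thesis using compact_Int_closed[OF D, of C] by (simp add: C_def inf.absorb2)
  qed
  moreover have "\<forall>S\<in>commutant K. open {y. dist x0 (S y) < r}"
  proof
    fix S assume "S \<in> commutant K"
    then have "bounded_linear S" by (simp add: commutant_def complex_bounded_linear_def)
    then show "open {y. dist x0 (S y) < r}"
      by (intro open_Collect_less continuous_on_dist continuous_on_const linear_continuous_on)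
  qed
  moreover have "C \<subseteq> (\<Union>S\<in>commutant K. {y. dist x0 (S y) < r})"
  proof
    fix y assume "y \<in> C"
    then have "y \<noteq> 0" using C_low[of y] mult_pos_pos[OF k r] by auto
    then have "x0 \<in> closure {S y |S. S \<in> commutant K}" using dense by simp
    then show "y \<in> (\<Union>S\<in>commutant K. {y. dist x0 (S y) < r})"
      using r unfolding closure_approachable by (fastforce simp: dist_commute)
  qed
  ultimately obtain F where F: "F \<subseteq> commutant K" "finite F" "C \<subseteq> (\<Union>S\<in>F. {y. dist x0 (S y) < r})"
    using compactE_image[of C "commutant K" "\<lambda>S. {y. dist x0 (S y) < r}"] by blast
  \<comment> \<open>A common bound for the norms of the maps in \<open>F\<close>; the summand 1
    keeps it positive even if \<open>F\<close> is empty.\<close>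
  define c where "c = 1 + (\<Sum>S\<in>F. onorm S)"
  have onS: "0 \<le> onorm S" if "S \<in> F" for S
    using that F by (intro onorm_pos_le) (auto simp: commutant_def complex_bounded_linear_def)
  have c0: "c > 0" using sum_nonneg[of F onorm] onS by (simp add: c_def)
  have cS: "norm (S x) \<le> c * norm x" if "S \<in> F" for S x
  proof -
    have "norm (S x) \<le> onorm S * norm x"
      using that F by (intro onorm) (auto simp: commutant_def complex_bounded_linear_def)
    also have "onorm S \<le> c" using member_le_sum[of S F onorm] onS that F by (simp add: c_def)
    finally show ?thesis by (simp add: mult_right_mono)
  qed
  have iter: "\<exists>S\<in>commutant K. S ((K ^^ n) x0) \<in> B \<and> (\<forall>x. norm (S x) \<le> c ^ n * norm x)" for n
  proof (induction n)
    case 0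
    show ?case using r commutant_id by (intro bexI[of _ "\<lambda>x. x"]) (auto simp: B_def)
  next
    case (Suc n)
    then obtain S where S: "S \<in> commutant K" "S ((K ^^ n) x0) \<in> B" "\<And>x. norm (S x) \<le> c ^ n * norm x"
      by blast
    have "K (S ((K ^^ n) x0)) \<in> C" unfolding C_def using S(2) by (intro subsetD[OF closure_subset] imageI)
    then obtain T where T: "T \<in> F" "dist x0 (T (K (S ((K ^^ n) x0)))) < r" using F(3) by blast
    \<comment> \<open>Commutation moves \<open>K\<close> inside \<open>S\<close>, so the new point
      again has the form of an operator applied to a power of \<open>K\<close> at
      \<open>x0\<close>.\<close>
    have e: "K (S ((K ^^ n) x0)) = S ((K ^^ Suc n) x0)" using S(1) by (simp add: commutant_def)
    show ?case
    proof (intro bexI conjI allI)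
      show "(\<lambda>x. T (S x)) \<in> commutant K" using T(1) F(1) S(1) commutant_compose by blast
      show "T (S ((K ^^ Suc n) x0)) \<in> B" using T(2) unfolding e B_def by simp
      show "norm (T (S x)) \<le> c ^ Suc n * norm x" for x
        using order_trans[OF cS[OF T(1), of "S x"] mult_left_mono[OF S(3)[of x], of c]] c0
        by (simp add: mult.assoc)
    qed
  qed
  \<comment> \<open>The radius \<open>2 * c\<close> rather than \<open>c\<close> leaves a factor
    \<open>(1 / 2) ^ n\<close> after the growth \<open>c ^ n\<close> has been absorbed.\<close>
  obtain N where N: "\<And>n. n \<ge> N \<Longrightarrow> (2 * c) ^ n * onorm (K ^^ n) \<le> 1" using quasi[of "2 * c"] c0 by auto
  have "(\<lambda>n. (1 / 2) ^ n * norm x0) \<longlonglongrightarrow> 0"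
    by (intro tendsto_mult_left_zero LIMSEQ_power_zero) simp
  then have "\<forall>\<^sub>F n in sequentially. (1 / 2) ^ n * norm x0 < r" using r by (rule order_tendstoD)
  then obtain n where n: "n \<ge> N" "(1 / 2) ^ n * norm x0 < r"
    unfolding eventually_sequentially by (metis nat_le_linear)
  obtain S where S: "S ((K ^^ n) x0) \<in> B" "\<And>x. norm (S x) \<le> c ^ n * norm x" using iter by blast
  have "norm (S ((K ^^ n) x0)) \<le> c ^ n * norm ((K ^^ n) x0)" by (rule S)
  also have "\<dots> \<le> c ^ n * (onorm (K ^^ n) * norm x0)"
    using complex_bounded_linear_funpow[OF cl] c0
    by (intro mult_left_mono onorm) (auto simp: complex_bounded_linear_def)
  also have "\<dots> = (1 / 2) ^ n * ((2 * c) ^ n * onorm (K ^^ n)) * norm x0"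
    by (simp add: power_mult_distrib power_one_over)
  also have "\<dots> \<le> (1 / 2) ^ n * 1 * norm x0"
    by (intro mult_right_mono mult_left_mono N n) auto
  finally have "norm (S ((K ^^ n) x0)) < r" using n by simp
  moreover have "norm (x0 - S ((K ^^ n) x0)) \<le> r" using S(1) by (simp add: B_def dist_norm)
  ultimately show False using rx0 norm_triangle_sub[of x0 "S ((K ^^ n) x0)"] by linarith
qed

text \<open>An eigenspace is invariant under the commutant, and proper because \<open>K\<close> is
  not scalar. Without eigenvalues \<open>K\<close> is quasinilpotent, and the closed commutant orbit
  of a non-cyclic vector serves.\<close>

theorem lomonosov:
  fixes K :: "'e::complex_banach_space \<Rightarrow> 'e"
  assumes K: "compact_operator K" and nonscalar: "\<And>c. K \<noteq> (\<lambda>x. c *\<^sub>C x)"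
  shows "\<exists>W. closed W \<and> cvs.subspace W \<and> (\<forall>S\<in>commutant K. S ` W \<subseteq> W) \<and> W \<noteq> {0} \<and> W \<noteq> UNIV"
proof (cases "\<exists>c x. x \<noteq> 0 \<and> K x = c *\<^sub>C x")
  case True
  then obtain c x where x: "x \<noteq> 0" "K x = c *\<^sub>C x" by blast
  have bl: "bounded_linear K" using compact_operatorD[OF K] by auto
  let ?W = "{v. K v = c *\<^sub>C v}"
  have "closed ?W"
    using bl by (intro closed_Collect_eq linear_continuous_on continuous_on_scaleC continuous_intros)
  moreover have "cvs.subspace ?W"
    by (rule cvs.subspaceI)
       (use bl in \<open>auto simp: linear_simps scaleC_add_right compact_operatorD[OF K] cvs.scale_left_commute\<close>)
  moreover have "\<forall>S\<in>commutant K. S ` ?W \<subseteq> ?W"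
    by (auto simp: commutant_def complex_bounded_linear_def)
  moreover have "?W \<noteq> {0}" using x by blast
  moreover have "?W \<noteq> UNIV" using nonscalar[of c] by auto
  ultimately show ?thesis by blast
next
  case False
  have cl: "complex_bounded_linear K" using compact_operatorD[OF K] by auto
  have "K \<noteq> (\<lambda>x. 0)" using nonscalar[of 0] by simp
  then obtain x0 where x0: "K x0 \<noteq> 0" by auto
  have "\<exists>N. \<forall>n\<ge>N. R ^ n * onorm (K ^^ n) \<le> 1" if "R > 0" for R
    using compact_operator_bounded_below[OF K, of R] False quasinilpotent_of_resolvent_bound[OF cl _ that]
    by metis
  from quasinilpotent_commutant_not_transitive[OF K x0 this]
  obtain y where y: "y \<noteq> 0" "closure {S y |S. S \<in> commutant K} \<noteq> UNIV" by blast
  then show ?thesis using closed_orbit_subspace[OF cl, where y = y] by blast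
qed

section \<open>Compact balls in finite dimension\<close>

text \<open>Induction on a spanning set. For a new vector \<open>b\<close> outside the old span, its
  positive distance \<open>d\<close> to that span controls the coefficient of \<open>b\<close>, so
  the ball lies in a continuous image of a compact product.\<close>

lemma cfinite_dim_cball_compact:
  assumes "cfinite_dim (UNIV :: 'a::complex_banach_space set)"
  shows "compact (cball (0::'a) r)"
proof -
  have "compact (cvs.span B \<inter> cball 0 r)" if "finite B" for B :: "'a set" and r
    using that
  proof (induction B arbitrary: r rule: finite_induct)
    case empty
    show ?case by (simp add: finite_imp_compact)
  next
    case (insert b B)
    let ?V = "cvs.span B"
    show ?case
    proof (cases "b \<in> ?V")
      case True
      then show ?thesis using insert.IH by (simp add: cvs.span_redundant)
    next
      case False
      \<comment> \<open>A convergent sequence is bounded, hence stays in a ball that is compact by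
        the induction hypothesis.\<close>
      have closed: "closed ?V"
        unfolding closed_sequential_limits
      proof clarify
        fix f l assume f: "\<forall>n. f n \<in> ?V" "f \<longlonglongrightarrow> l"
        then obtain R where "\<And>n. norm (f n) \<le> R"
          using convergent_imp_Bseq[of f] by (auto simp: convergent_def Bseq_def)
        with f have "\<forall>n. f n \<in> ?V \<inter> cball 0 R" by simp
        then show "l \<in> ?V"
          using closed_sequentially[OF compact_imp_closed[OF insert.IH[of R]]] f(2) by blast
      qed
      define d where "d = infdist b ?V"
      have d: "0 < d" unfolding d_def
        by (rule infdist_pos_not_in_closed[OF closed _ False]) (use cvs.span_zero in blast)
      let ?P = "cball (0::complex) (r / d) \<times> (?V \<inter> cball 0 (r + r / d * norm b))"
      let ?f = "\<lambda>(c, u). c *\<^sub>C b + u"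
      have cpt: "compact (?f ` ?P)"
        unfolding case_prod_unfold
        by (intro compact_continuous_image compact_Times insert.IH compact_cball
            continuous_on_add continuous_on_scaleC continuous_intros)
      have "cvs.span (insert b B) \<inter> cball 0 r = ?f ` ?P \<inter> cball 0 r"
      proof (intro equalityI subsetI IntI)
        fix v assume v: "v \<in> cvs.span (insert b B) \<inter> cball 0 r"
        then obtain c where c: "v - c *\<^sub>C b \<in> ?V" by (auto simp: cvs.span_breakdown_eq)
        have nv: "norm v \<le> r" using v by simp
        have "cmod c * d \<le> norm v"
        proof (cases "c = 0")
          case False
          \<comment> \<open>Dividing by \<open>c\<close> normalises the coefficient of
            \<open>b\<close>: \<open>b - (1 / c) *\<^sub>C v\<close> lies in the old span, at
            distance \<open>norm v / cmod c\<close> from \<open>b\<close>.\<close>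
          have "(- 1 / c) *\<^sub>C (v - c *\<^sub>C b) \<in> ?V" using c by (rule cvs.span_scale)
          moreover have "(- 1 / c) *\<^sub>C (v - c *\<^sub>C b) = b - (1 / c) *\<^sub>C v"
            using False by (simp add: cvs.scale_right_diff_distrib)
          ultimately have "b - (1 / c) *\<^sub>C v \<in> ?V" by simp
          then have "d \<le> dist b (b - (1 / c) *\<^sub>C v)" unfolding d_def by (rule infdist_le)
          also have "\<dots> = norm v / cmod c" by (simp add: dist_norm norm_scaleC norm_divide)
          finally show ?thesis using False by (simp add: field_simps)
        qed simp
        then have c1: "cmod c \<le> r / d" using nv d by (simp add: field_simps)
        have "norm (v - c *\<^sub>C b) \<le> norm v + cmod c * norm b"
          using norm_triangle_ineq4[of v "c *\<^sub>C b"] by (simp add: norm_scaleC)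
        also have "\<dots> \<le> r + r / d * norm b" by (intro add_mono nv mult_right_mono c1) simp
        finally have "(c, v - c *\<^sub>C b) \<in> ?P" using c c1 by simp
        then show "v \<in> ?f ` ?P" by (rule rev_image_eqI) simp
      next
        fix v assume "v \<in> ?f ` ?P \<inter> cball 0 r"
        then obtain c u where "v = c *\<^sub>C b + u" "u \<in> ?V" by auto
        then show "v \<in> cvs.span (insert b B)"
          unfolding cvs.span_breakdown_eq by (intro exI[of _ c]) simp
      qed auto
      then show ?thesis using compact_Int_closed[OF cpt closed_cball] by simp
    qed
  qed
  moreover obtain B :: "'a set" where "finite B" "cvs.span B = UNIV"
    using assms by (auto simp: cfinite_dim_def)
  ultimately show ?thesis by (metis inf_top_left)
qed

section \<open>Norm estimates in Hilbert modules and boundedness of adjointable maps\<close>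

lemma norm_cstar [simp]: "norm (cstar a) = norm (a :: 'a::cstar_algebra)"
proof -
  have le: "norm a \<le> norm (cstar a)" for a :: 'a
  proof (cases "a = 0")
    case False
    have "norm a * norm a \<le> norm (cstar a) * norm a"
      using norm_mult_ineq[of "cstar a" a] by (simp add: cstar_identity power2_eq_square)
    then show ?thesis using False by simp
  qed simp
  from le[of a] le[of "cstar a"] show ?thesis by (simp add: cstar_cstar)
qed

context hilbert_module
begin

lemma ip_add_left: "ip (x + y) z = ip x z + ip y z"
  by (metis ip_commute ip_add_right cstar_add)

lemma ip_scaleC_left: "ip (c *\<^sub>C x) z = cnj c *\<^sub>C ip x z"
  by (metis ip_commute ip_scaleC_right cstar_scaleC)

lemma ip_act_left: "ip (act x a) z = cstar a * ip x z"
  by (metis ip_commute ip_act_right cstar_mult)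

lemma ip_diff_left: "ip (x - y) z = ip x z - ip y z"
  using ip_add_left[of "x - y" y z] by simp

lemma norm_ip_self: "norm (ip x x) = (norm x)\<^sup>2"
  by (simp add: norm_ip)

lemma ip_eqI: "(\<And>z. ip x z = ip y z) \<Longrightarrow> x = y"
  using ip_definite[of "x - y"] by (simp add: ip_diff_left)

lemma norm_act: "norm (act x a) \<le> norm a * norm x"
proof -
  have "(norm (act x a))\<^sup>2 = norm (cstar a * ip x x * a)"
    by (simp add: ip_act_left ip_act_right mult.assoc flip: norm_ip_self)
  also have "\<dots> \<le> norm (cstar a) * norm (ip x x) * norm a"
    using norm_mult_ineq[of "cstar a * ip x x" a] norm_mult_ineq[of "cstar a" "ip x x"]
    by (meson mult_right_mono norm_ge_zero order_trans)
  also have "\<dots> = (norm a * norm x)\<^sup>2"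
    by (simp add: norm_ip_self power2_eq_square mult_ac)
  finally show ?thesis by (rule power2_le_imp_le) simp
qed

text \<open>Reduces mixed inner products to the squares \<open>ip z z\<close>, whose norms are known
  from \<open>norm_ip\<close>.\<close>

lemma ip_polarization:
  "4 *\<^sub>C ip x y = ip (x + y) (x + y) - ip (x - y) (x - y)
     - \<i> *\<^sub>C ip (x + \<i> *\<^sub>C y) (x + \<i> *\<^sub>C y) + \<i> *\<^sub>C ip (x - \<i> *\<^sub>C y) (x - \<i> *\<^sub>C y)"
proof -
  have diff_right: "ip x (y - z) = ip x y - ip x z" for x y z
    using ip_add_right[of x "y - z" z] by simp
  have "4 *\<^sub>C ip x y = (1 + 1 + 1 + 1 :: complex) *\<^sub>C ip x y" by simp
  also have "\<dots> = ip x y + ip x y + ip x y + ip x y"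
    by (simp only: scaleC_add_left scaleC_one)
  finally show ?thesis
    by (simp add: ip_add_left ip_add_right ip_diff_left diff_right ip_scaleC_left ip_scaleC_right
        scaleC_add_right cvs.scale_right_diff_distrib scaleC_scaleC)
qed

text \<open>
  The constant is not sharp, but this bound needs only the triangle inequality of the given norm
  and no order on the algebra.
\<close>

lemma norm_ip_le: "norm (ip x y) \<le> 4 * norm x * norm y"
proof -
  have unit: "norm (ip x y) \<le> 4" if "norm x = 1" "norm y = 1" for x y
  proof -
    have q: "norm (ip z z) \<le> 4" if "norm z \<le> 2" for z
      using power_mono[OF that, of 2] by (simp add: norm_ip_self)
    have b: "norm (x + y) \<le> 2" "norm (x - y) \<le> 2" "norm (x + \<i> *\<^sub>C y) \<le> 2" "norm (x - \<i> *\<^sub>C y) \<le> 2"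
      using norm_triangle_ineq[of x y] norm_triangle_ineq4[of x y] norm_triangle_ineq[of x "\<i> *\<^sub>C y"]
        norm_triangle_ineq4[of x "\<i> *\<^sub>C y"] that by (simp_all add: norm_scaleC)
    have tri: "norm (p - q - \<i> *\<^sub>C r + \<i> *\<^sub>C s) \<le> norm p + norm q + norm r + norm s" for p q r s :: 'a
      using norm_triangle_ineq[of "p - q - \<i> *\<^sub>C r" "\<i> *\<^sub>C s"] norm_triangle_ineq4[of "p - q" "\<i> *\<^sub>C r"]
        norm_triangle_ineq4[of p q] by (simp add: norm_scaleC)
    have "norm (4 *\<^sub>C ip x y) \<le> 16"
      unfolding ip_polarization[of x y] by (rule order_trans[OF tri]) (use b[THEN q] in linarith)
    then show ?thesis by (simp add: norm_scaleC)
  qed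
  show ?thesis
  proof (cases "x = 0 \<or> y = 0")
    case True
    have "ip x 0 = 0" "ip 0 y = 0"
      using ip_scaleC_right[of x 0 0] ip_scaleC_left[of 0 0 y] by simp_all
    with True show ?thesis by auto
  next
    case False
    let ?x = "complex_of_real (1 / norm x) *\<^sub>C x" and ?y = "complex_of_real (1 / norm y) *\<^sub>C y"
    have "norm (ip ?x ?y) \<le> 4" by (rule unit) (use False in \<open>simp_all add: norm_scaleC norm_divide\<close>)
    then show ?thesis using False
      by (simp add: ip_scaleC_left ip_scaleC_right norm_scaleC norm_divide norm_mult field_simps)
  qed
qed

lemma complex_bounded_linear_act: "complex_bounded_linear (\<lambda>x. act x a)"
  by (rule complex_bounded_linearI[where B = "norm a"])
     (simp_all add: act_add_left act_scaleC_left norm_act)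

lemma complex_bounded_linear_act_right: "complex_bounded_linear (act x)"
  by (rule complex_bounded_linearI[where B = "norm x"])
     (use norm_act in \<open>simp_all add: act_add_right act_scaleC_right mult.commute\<close>)

lemma complex_bounded_linear_ip: "complex_bounded_linear (ip x)"
  by (rule complex_bounded_linearI[where B = "4 * norm x"])
     (simp_all add: ip_add_right ip_scaleC_right norm_ip_le)

lemma adjointable_act:
  assumes "T \<in> adjointable_ops ip"
  shows "T (act x a) = act (T x) a"
  using assms by (auto simp: adjointable_ops_def ip_act_left intro: ip_eqI)

text \<open>Linearity follows by moving \<open>T\<close> to the other side of the inner product. For
  boundedness, closed sets \<open>F n\<close> cover the module; by Baire one of them contains a
  ball, and differences of its points bound \<open>T\<close> near 0.\<close>

lemma adjointable_complex_bounded_linear: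
  assumes "T \<in> adjointable_ops ip"
  shows "complex_bounded_linear T"
proof -
  obtain T' where T': "\<And>x y. ip (T x) y = ip x (T' y)" using assms by (auto simp: adjointable_ops_def)
  have add: "T (x + y) = T x + T y" for x y by (rule ip_eqI) (simp add: T' ip_add_left)
  have scale: "T (c *\<^sub>C x) = c *\<^sub>C T x" for c x by (rule ip_eqI) (simp add: T' ip_scaleC_left)
  have diff: "T (x - y) = T x - T y" for x y using add[of "x - y" y] by simp
  have flip: "ip y (T x) = ip (T' y) x" for x y by (metis ip_commute T')
  \<comment> \<open>Writing the condition with \<open>T'\<close> makes each set closed:
    \<open>ip (T' y)\<close> is known to be continuous, while \<open>T\<close> is not yet.\<close>
  define F where "F n = (\<Inter>y\<in>cball 0 1. {x. norm (ip (T' y) x) \<le> real n})" for n :: nat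
  have clF: "closed (F n)" for n
    unfolding F_def
    by (intro closed_INT ballI closed_Collect_le continuous_on_norm continuous_on_const
        linear_continuous_on complex_bounded_linearD(1) complex_bounded_linear_ip)
  have "(\<Union>n. F n) = UNIV"
  proof (intro equalityI subsetI)
    fix x :: 'e
    obtain n :: nat where n: "4 * norm (T x) \<le> real n" using real_arch_simple by blast
    have "norm (ip (T' y) x) \<le> real n" if "norm y \<le> 1" for y
    proof -
      have "norm (ip (T' y) x) \<le> 4 * norm y * norm (T x)" using norm_ip_le[of y "T x"] by (simp add: flip)
      also have "\<dots> \<le> 4 * 1 * norm (T x)" using that by (intro mult_right_mono mult_left_mono) auto
      finally show ?thesis using n by simp
    qed
    then have "x \<in> F n" by (simp add: F_def)
    then show "x \<in> (\<Union>n. F n)" by blast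
  qed simp
  then have "euclidean interior_of (\<Union>(range F)) \<noteq> {}" by simp
  then have "\<exists>n. interior (F n) \<noteq> {}"
    using Baire_category_alt[OF disjI1[OF completely_metrizable_space_euclidean], of "range F"] clF
    by (auto simp: closed_closedin[symmetric])
  then obtain n x0 e where e: "0 < e" "ball x0 e \<subseteq> F n" by (auto simp: mem_interior)
  have TF: "norm (ip y (T x)) \<le> real n" if "x \<in> F n" "norm y \<le> 1" for x y
    using that by (auto simp: F_def flip)
  have small: "norm (T x) \<le> 2 * real n" if "norm x < e" for x
  proof (cases "T x = 0")
    case False
    \<comment> \<open>Testing \<open>T x\<close> against its own direction recovers
      \<open>norm (T x)\<close>; \<open>x\<close> is then the difference of \<open>x0 + x\<close>
      and \<open>x0\<close>, both in \<open>F n\<close>.\<close>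
    let ?y = "complex_of_real (1 / norm (T x)) *\<^sub>C T x"
    have y: "norm ?y \<le> 1" using False by (simp add: norm_scaleC norm_divide)
    have in_F: "x0 + x \<in> F n" "x0 \<in> F n" using e that by (auto simp: dist_norm)
    have "norm (T x) = norm (ip ?y (T x))"
      using False by (simp add: ip_scaleC_left norm_scaleC norm_divide norm_ip_self power2_eq_square)
    also have "ip ?y (T x) = ip ?y (T (x0 + x)) - ip ?y (T x0)" by (simp add: add ip_add_right)
    also have "norm \<dots> \<le> real n + real n"
      using norm_triangle_ineq4 TF[OF in_F(1) y] TF[OF in_F(2) y] add_mono order_trans by metis
    finally show ?thesis by simp
  qed simp
  have bound: "norm (T x) \<le> (4 * real n / e) * norm x" for x
  proof (cases "x = 0")
    case True
    then show ?thesis using scale[of 0 0] by simp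
  next
    case False
    let ?c = "complex_of_real (e / (2 * norm x))"
    have "norm (?c *\<^sub>C x) < e" using False e by (simp add: norm_scaleC norm_divide norm_mult)
    from small[OF this] show ?thesis using False e
      by (simp add: scale norm_scaleC norm_divide norm_mult field_simps)
  qed
  show ?thesis by (rule complex_bounded_linearI[OF add scale bound])
qed

section \<open>Compact module operators as compact operators\<close>

text \<open>The map factors through the algebra: \<open>ip y\<close> sends the unit ball into a ball
  there, which is compact in finite dimension.\<close>

lemma theta_op_image_compact:
  assumes "cfinite_dim (UNIV :: 'a set)"
  shows "\<exists>C. compact C \<and> (\<forall>z\<in>cball 0 1. c *\<^sub>C theta_op act ip x y z \<in> C)"
proof -
  let ?C = "(\<lambda>a. c *\<^sub>C act x a) ` cball 0 (4 * norm y)"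
  have "complex_bounded_linear (\<lambda>a. c *\<^sub>C act x a)"
    by (intro complex_bounded_linear_compose[OF complex_bounded_linear_scaleC] complex_bounded_linear_act_right)
  then have "compact ?C"
    by (intro compact_continuous_image linear_continuous_on complex_bounded_linearD(1)
        cfinite_dim_cball_compact[OF assms])
  moreover have "c *\<^sub>C theta_op act ip x y z \<in> ?C" if "z \<in> cball 0 1" for z
  proof -
    have "norm (ip y z) \<le> 4 * norm y * norm z" by (rule norm_ip_le)
    also have "\<dots> \<le> 4 * norm y" using that by (simp add: mult_left_le)
    finally show ?thesis by (auto simp: theta_op_def)
  qed
  ultimately show ?thesis by blast
qed

lemma theta_span_image_compact:
  assumes "cfinite_dim (UNIV :: 'a set)" "F \<in> theta_span act ip"
  shows "\<exists>C. compact C \<and> F ` cball 0 1 \<subseteq> C"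
proof -
  obtain n :: nat and c x y where F: "F = (\<lambda>z. \<Sum>i<n. c i *\<^sub>C theta_op act ip (x i) (y i) z)"
    using assms(2) by (auto simp: theta_span_def)
  have "\<exists>C. compact C \<and> (\<forall>z\<in>cball 0 1. (\<Sum>i<n. c i *\<^sub>C theta_op act ip (x i) (y i) z) \<in> C)"
  proof (induction n)
    case 0
    show ?case by (intro exI[of _ "{0}"]) simp
  next
    case (Suc n)
    then obtain C where C: "compact C" "\<forall>z\<in>cball 0 1. (\<Sum>i<n. c i *\<^sub>C theta_op act ip (x i) (y i) z) \<in> C"
      by blast
    obtain D where D: "compact D" "\<forall>z\<in>cball 0 1. c n *\<^sub>C theta_op act ip (x n) (y n) z \<in> D"
      using theta_op_image_compact[OF assms(1)] by blast
    have "compact {u + v |u v. u \<in> C \<and> v \<in> D}" by (rule compact_sums[OF C(1) D(1)])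
    then show ?case using C(2) D(2) by (intro exI[of _ "{u + v |u v. u \<in> C \<and> v \<in> D}"]) auto
  qed
  then show ?thesis unfolding F by auto
qed

text \<open>Total boundedness passes from the image of the unit ball under an approximating
  \<open>F\<close> to its image under \<open>K\<close>.\<close>

lemma compact_module_op_compact_operator:
  assumes "cfinite_dim (UNIV :: 'a set)" "K \<in> compact_module_ops act ip"
  shows "compact_operator K"
proof -
  have "K \<in> adjointable_ops ip" using assms(2) by (simp add: compact_module_ops_def)
  then have "complex_bounded_linear K" by (rule adjointable_complex_bounded_linear)
  moreover have "compact (closure (K ` cball 0 1))"
    unfolding compact_eq_totally_bounded
  proof (intro conjI allI impI)
    show "complete (closure (K ` cball 0 1))" by (simp add: complete_eq_closed)
    fix \<epsilon> :: real assume \<epsilon>: "\<epsilon> > 0"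
    obtain F where F: "F \<in> theta_span act ip" "\<And>z. norm (K z - F z) \<le> \<epsilon> / 4 * norm z"
      using assms(2) \<epsilon> by (auto simp: compact_module_ops_def dest!: spec[of _ "\<epsilon> / 4"])
    obtain C where C: "compact C" "F ` cball 0 1 \<subseteq> C" using theta_span_image_compact[OF assms(1) F(1)] by blast
    obtain k where k: "finite k" "C \<subseteq> (\<Union>x\<in>k. ball x (\<epsilon> / 4))"
      using C(1) \<epsilon> unfolding compact_eq_totally_bounded by (metis zero_less_divide_iff zero_less_numeral)
    \<comment> \<open>Closed balls are used so that the inclusion survives taking the closure;
      radius \<epsilon>/2 leaves room to return to open balls of radius \<epsilon>.\<close>
    have "K ` cball 0 1 \<subseteq> (\<Union>x\<in>k. cball x (\<epsilon> / 2))"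
    proof clarify
      fix z :: 'e assume z: "z \<in> cball 0 1"
      then obtain x where x: "x \<in> k" "dist x (F z) < \<epsilon> / 4" using C(2) k(2) by fastforce
      have "norm (K z - F z) \<le> \<epsilon> / 4"
      proof -
        have "\<epsilon> / 4 * norm z \<le> \<epsilon> / 4" by (rule mult_left_le) (use z \<epsilon> in auto)
        with F(2)[of z] show ?thesis by linarith
      qed
      then have "dist x (K z) \<le> \<epsilon> / 2"
        using x(2) dist_triangle[of x "K z" "F z"] by (simp add: dist_norm norm_minus_commute)
      then show "K z \<in> (\<Union>x\<in>k. cball x (\<epsilon> / 2))" using x(1) by auto
    qed
    moreover have "closed (\<Union>x\<in>k. cball x (\<epsilon> / 2))" using k(1) by (intro closed_UN) auto
    ultimately have "closure (K ` cball 0 1) \<subseteq> (\<Union>x\<in>k. cball x (\<epsilon> / 2))" by (rule closure_minimal)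
    also have "\<dots> \<subseteq> (\<Union>x\<in>k. ball x \<epsilon>)" using \<epsilon> by fastforce
    finally show "\<exists>k. finite k \<and> closure (K ` cball 0 1) \<subseteq> (\<Union>x\<in>k. ball x \<epsilon>)" using k(1) by blast
  qed
  ultimately show ?thesis by (simp add: compact_operator_def)
qed

section \<open>Scalar operators and finite generation\<close>

text \<open>The vectors \<open>x i\<close> generate. Since generators form a set, the coefficients
  of indices with equal \<open>x i\<close> are added up.\<close>

lemma theta_span_range_fin_gen:
  assumes "F \<in> theta_span act ip" "surj F"
  shows "fin_gen_module act"
proof -
  obtain n :: nat and c x y where F: "F = (\<lambda>z. \<Sum>i<n. c i *\<^sub>C theta_op act ip (x i) (y i) z)"
    using assms(1) by (auto simp: theta_span_def)
  have act_sum: "act g (\<Sum>i\<in>I. f i) = (\<Sum>i\<in>I. act g (f i))" for g I and f :: "nat \<Rightarrow> 'a"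
    using linear_sum[OF bounded_linear.linear[OF complex_bounded_linearD(1)[OF complex_bounded_linear_act_right]]]
    by blast
  have "\<exists>a. v = (\<Sum>g\<in>x ` {..<n}. act g (a g))" for v
  proof -
    obtain z where z: "v = F z" using assms(2) by blast
    define b where "b i = c i *\<^sub>C ip (y i) z" for i
    have "v = (\<Sum>i<n. act (x i) (b i))"
      unfolding z F by (simp add: theta_op_def b_def act_scaleC_right)
    also have "\<dots> = (\<Sum>g\<in>x ` {..<n}. \<Sum>i | i \<in> {..<n} \<and> x i = g. act (x i) (b i))"
      by (rule sum.image_gen) simp
    also have "\<dots> = (\<Sum>g\<in>x ` {..<n}. act g (\<Sum>i | i \<in> {..<n} \<and> x i = g. b i))"
      by (intro sum.cong refl) (simp add: act_sum)
    finally show ?thesis by (rule exI[of _ "\<lambda>g. \<Sum>i | i \<in> {..<n} \<and> x i = g. b i"])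
  qed
  then show ?thesis unfolding fin_gen_module_def by (intro exI[of _ "x ` {..<n}"]) auto
qed

text \<open>
  An operator in the span of the rank-one maps that is close to an invertible scalar is
  surjective, by Banach's fixed point theorem.
\<close>

lemma scalar_compact_module_op_fin_gen:
  assumes K: "(\<lambda>x. c *\<^sub>C x) \<in> compact_module_ops act ip" and c: "c \<noteq> 0"
  shows "fin_gen_module act"
proof -
  obtain F where F: "F \<in> theta_span act ip" "\<And>z. norm (c *\<^sub>C z - F z) \<le> cmod c / 2 * norm z"
    using K c by (auto simp: compact_module_ops_def dest!: spec[of _ "cmod c / 2"])
  obtain n :: nat and d x y where Fdef: "F = (\<lambda>z. \<Sum>i<n. d i *\<^sub>C theta_op act ip (x i) (y i) z)"
    using F(1) by (auto simp: theta_span_def)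
  have F_add: "F (u + v) = F u + F v" for u v
    unfolding Fdef by (simp add: theta_op_def ip_add_right act_add_right scaleC_add_right sum.distrib)
  have F_diff: "F (u - v) = F u - F v" for u v using F_add[of "u - v" v] by simp
  have "surj F"
    unfolding surj_def
  proof
    fix v
    \<comment> \<open>The fixed points of \<open>?g\<close> are the solutions of
      \<open>F z = v\<close>; the accuracy \<open>cmod c / 2\<close> of \<open>F\<close> makes the
      contraction factor 1/2.\<close>
    let ?g = "\<lambda>z. (1 / c) *\<^sub>C (v + (c *\<^sub>C z - F z))"
    have "dist (?g z) (?g w) \<le> 1 / 2 * dist z w" for z w
    proof -
      have "?g z - ?g w = (1 / c) *\<^sub>C (c *\<^sub>C (z - w) - F (z - w))"
        by (simp only: F_diff cvs.scale_right_diff_distrib scaleC_add_right) simp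
      then have "dist (?g z) (?g w) = norm (c *\<^sub>C (z - w) - F (z - w)) / cmod c"
        by (simp add: dist_norm norm_scaleC norm_divide)
      also have "\<dots> \<le> (cmod c / 2 * norm (z - w)) / cmod c" using F(2) by (intro divide_right_mono) auto
      finally show ?thesis using c by (simp add: dist_norm)
    qed
    then have "\<exists>!z. ?g z = z" by (intro banach_fix_type[where c = "1 / 2"]) auto
    then obtain z where z: "?g z = z" by blast
    have "c *\<^sub>C ?g z = c *\<^sub>C z" by (simp only: z)
    then have "v = F z" using c by (simp add: scaleC_scaleC scaleC_one)
    then show "\<exists>z. v = F z" ..
  qed
  with F(1) show ?thesis by (rule theta_span_range_fin_gen)
qed

end

section \<open>From commutant-invariant subspaces to hyperinvariant submodules\<close>

theorem theorem4p8:
  fixes act :: "'e::complex_banach_space \<Rightarrow> 'a::cstar_algebra \<Rightarrow> 'e"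
    and ip :: "'e \<Rightarrow> 'e \<Rightarrow> 'a"
    and K :: "'e \<Rightarrow> 'e"
  assumes "cfinite_dim (UNIV :: 'a set)"
    and "hilbert_module act ip"
    and "\<not> fin_gen_module act"
    and "K \<in> compact_module_ops act ip"
    and "K \<noteq> (\<lambda>x. 0)"
  shows "\<exists>W. hyperinvariant_submodule act ip K W \<and> W \<noteq> {0} \<and> W \<noteq> UNIV"
proof -
  interpret hilbert_module act ip by (rule assms(2))
  have K: "compact_operator K" using assms(1,4) by (rule compact_module_op_compact_operator)
  have adj: "K \<in> adjointable_ops ip" using assms(4) by (simp add: compact_module_ops_def)
  have "K \<noteq> (\<lambda>x. c *\<^sub>C x)" for c
    using scalar_compact_module_op_fin_gen[of c] assms(3,4,5) by (cases "c = 0") auto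
  then obtain W where W: "closed W" "cvs.subspace W" "\<And>S. S \<in> commutant K \<Longrightarrow> S ` W \<subseteq> W"
      "W \<noteq> {0}" "W \<noteq> UNIV"
    using lomonosov[OF K] by metis
  have "K \<in> commutant K" using compact_operatorD(1)[OF K] by (simp add: commutant_def)
  \<comment> \<open>Module linearity of \<open>K\<close> enters here; invariance under these maps
    makes the subspace \<open>W\<close> a submodule.\<close>
  moreover have "(\<lambda>x. act x a) \<in> commutant K" for a
    using complex_bounded_linear_act adjointable_act[OF adj] by (simp add: commutant_def)
  moreover have "S \<in> commutant K" if "S \<in> adjointable_ops ip" "K \<circ> S = S \<circ> K" for S
    using that adjointable_complex_bounded_linear[OF that(1)]
    by (simp add: commutant_def fun_eq_iff)
  ultimately have "hyperinvariant_submodule act ip K W"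
    using W(1,2,3)
    unfolding hyperinvariant_submodule_def invariant_submodule_def closed_submodule_def by fast
  with W(4,5) show ?thesis by blast
qed

end
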